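(* Let $A$ be a finite nonempty set and $Q\subseteq\mathrm{gQuord}(A)$. Then each relation obtained from $Q$ by a quantifier-free primitive positive formula is also a generalized quasiorder, i.e., $[\mathrm{gQuord}(A)]_{(\land,=)}=\mathrm{gQuord}(A)$. Moreover, given an algebra $(A,F)$ with $F$ a set of finitary operations on $A$, and $Q\subseteq\mathrm{gQuord}(A,F)$, we have $[Q]_{(\land,=)}\subseteq\mathrm{gQuord}(A,F)$.
   Context: All operations and relations have finite arity $\ge1$. A relation $\rho\subseteq A^m$ is reflexive if $(a,\dots,a)\in\rho$ for all $a\in A$; it is (generalized) transitive if for every matrix $(a_{ij})\in A^{m\times m}$ all of whose rows and all of whose columns belong to $\rho$, the diagonal $(a_{11},\dots,a_{mm})$ belongs to $\rho$. A generalized quasiorder is a reflexive and transitive relation $\rho\subseteq A^m$ for some $m\ge1$; $\mathrm{gQuord}(A)$ is the set of all of them (all arities). An operation $f:A^n\to A$ preserves $\rho\subseteq A^m$ if applying $f$ componentwise to any $r_1,\dots,r_n\in\rho$ gives a tuple in $\rho$. $\mathrm{gQuord}(A,F)$ is the set of all generalized quasiorders on $A$ preserved by every $f\in F$. For a set $Q$ of relations on $A$, $[Q]_{(\land,=)}$ is the set of all relations $\{(a_1,\dots,a_m)\in A^m\mid\varphi(a_1,\dots,a_m)\}$, $m\ge1$, where $\varphi(x_1,\dots,x_m)$ is a finite conjunction of atomic formulas of the form $(x_{i_1},\dots,x_{i_s})\in\sigma$ (with $\sigma\in Q$ $s$-ary and $i_1,\dots,i_s\in\{1,\dots,m\}$,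 not necessarily distinct) or $x_i=x_j$. *)

theory Defs
  imports Main
begin

definition tuples :: "'a set \<Rightarrow> nat \<Rightarrow> 'a list set" where
  "tuples A m = {xs. length xs = m \<and> set xs \<subseteq> A}"

text \<open>
  A finitary relation is a pair of its arity and its set of tuples; the explicit arity keeps
  empty relations of different arities apart.
\<close>

type_synonym 'a relation = "nat \<times> 'a list set"

definition relation_on :: "'a set \<Rightarrow> 'a relation \<Rightarrow> bool" where
  "relation_on A = (\<lambda>(m, R). m \<ge> 1 \<and> R \<subseteq> tuples A m)"

definition reflexive_rel :: "'a set \<Rightarrow> 'a relation \<Rightarrow> bool" where
  "reflexive_rel A = (\<lambda>(m, R). \<forall>a\<in>A. replicate m a \<in> R)"

text \<open>Rows, columns and tuple positions are indexed by \<open>0, \<dots>, m - 1\<close>.\<close>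

definition transitive_rel :: "'a set \<Rightarrow> 'a relation \<Rightarrow> bool" where
  "transitive_rel A = (\<lambda>(m, R). \<forall>M :: nat \<Rightarrow> nat \<Rightarrow> 'a.
     (\<forall>i<m. \<forall>j<m. M i j \<in> A) \<longrightarrow>
     (\<forall>i<m. map (\<lambda>j. M i j) [0..<m] \<in> R) \<longrightarrow>
     (\<forall>j<m. map (\<lambda>i. M i j) [0..<m] \<in> R) \<longrightarrow>
     map (\<lambda>i. M i i) [0..<m] \<in> R)"

definition gQuord :: "'a set \<Rightarrow> 'a relation set" where
  "gQuord A = {\<rho>. relation_on A \<rho> \<and> reflexive_rel A \<rho> \<and> transitive_rel A \<rho>}"

text \<open>
  An operation is a pair of its arity and a function on argument lists, of which only the
  values on \<open>tuples A n\<close> matter.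
\<close>

type_synonym 'a operation = "nat \<times> ('a list \<Rightarrow> 'a)"

definition operation_on :: "'a set \<Rightarrow> 'a operation \<Rightarrow> bool" where
  "operation_on A = (\<lambda>(n, f). n \<ge> 1 \<and> (\<forall>xs\<in>tuples A n. f xs \<in> A))"

definition preserves :: "'a operation \<Rightarrow> 'a relation \<Rightarrow> bool" where
  "preserves = (\<lambda>(n, f) (m, R). \<forall>rs. length rs = n \<longrightarrow> set rs \<subseteq> R \<longrightarrow>
     map (\<lambda>j. f (map (\<lambda>r. r ! j) rs)) [0..<m] \<in> R)"

definition gQuord_alg :: "'a set \<Rightarrow> 'a operation set \<Rightarrow> 'a relation set" where
  "gQuord_alg A F = {\<rho> \<in> gQuord A. \<forall>f\<in>F. preserves f \<rho>}"

text \<open>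
  Atomic formulas in the variables \<open>x\<^sub>0, \<dots>, x\<^bsub>m-1\<^esub>\<close>, represented by their indices.
\<close>

datatype 'a atomic =
    In_Rel "nat list" "'a relation"
  | Equal nat nat

fun atomic_over :: "'a relation set \<Rightarrow> nat \<Rightarrow> 'a atomic \<Rightarrow> bool" where
  "atomic_over Q m (In_Rel is \<sigma>) \<longleftrightarrow> \<sigma> \<in> Q \<and> length is = fst \<sigma> \<and> set is \<subseteq> {..<m}"
| "atomic_over Q m (Equal i j) \<longleftrightarrow> i < m \<and> j < m"

fun holds :: "'a list \<Rightarrow> 'a atomic \<Rightarrow> bool" where
  "holds as (In_Rel is \<sigma>) \<longleftrightarrow> map (\<lambda>i. as ! i) is \<in> snd \<sigma>"
| "holds as (Equal i j) \<longleftrightarrow> as ! i = as ! j"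

text \<open>
  The closure \<open>[Q]\<close> under quantifier-free primitive positive formulas. A list of atomic formulas
  stands for its conjunction; the empty conjunction adds nothing, being equivalent to
  \<open>x\<^sub>0 = x\<^sub>0\<close> because \<open>m \<ge> 1\<close>.
\<close>

definition qf_pp_closure :: "'a set \<Rightarrow> 'a relation set \<Rightarrow> 'a relation set" where
  "qf_pp_closure A Q =
     {(m, {as \<in> tuples A m. \<forall>\<alpha>\<in>set \<phi>. holds as \<alpha>}) | m \<phi>.
        m \<ge> 1 \<and> (\<forall>\<alpha>\<in>set \<phi>. atomic_over Q m \<alpha>)}"

end

theory Submission
  imports Defs
begin

text \<open>
  If all rows and columns of a square matrix satisfy \<open>\<sigma>(x\<^bsub>i\<^sub>1\<^esub>, \<dots>, x\<^bsub>i\<^sub>s\<^esub>)\<close>, then all rows and columns of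
  the \<open>s \<times> s\<close> matrix that it induces on the indices \<open>i\<^sub>1, \<dots>, i\<^sub>s\<close>, repetitions included, belong
  to \<open>\<sigma>\<close>, hence so does its diagonal. For an atom \<open>x\<^sub>i = x\<^sub>j\<close>, row \<open>i\<close> and column \<open>j\<close> identify both
  diagonal entries with the entry at \<open>(i, j)\<close>.
\<close>

lemma holds_replicate:
  assumes "atomic_over Q m \<alpha>" and "Q \<subseteq> gQuord A" and "a \<in> A"
  shows "holds (replicate m a) \<alpha>"
proof (cases \<alpha>)
  case (In_Rel "is" \<sigma>)
  then have "\<sigma> \<in> gQuord A" and len: "length is = fst \<sigma>" and sub: "set is \<subseteq> {..<m}"
    using assms by auto
  then have "replicate (length is) a \<in> snd \<sigma>"
    using \<open>a \<in> A\<close> by (auto simp: gQuord_def reflexive_rel_def)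
  moreover have "map (\<lambda>i. replicate m a ! i) is = replicate (length is) a"
    using sub by (intro nth_equalityI) (auto simp: subset_iff)
  ultimately show ?thesis
    using In_Rel by simp
next
  case (Equal i j)
  then show ?thesis using assms by simp
qed

text \<open>Serves to evaluate a relational atom at a row, a column, a diagonal or a componentwise
  image. The bound on \<open>is\<close> keeps every lookup inside the list, where \<open>!\<close>
  is determined.\<close>

lemma map_nth_map_upt:
  assumes "set is \<subseteq> {..<m}"
  shows "map (\<lambda>i. map g [0..<m] ! i) is = map (\<lambda>k. g (is ! k)) [0..<length is]"
  using assms by (intro nth_equalityI) (auto simp: subset_iff)

lemma holds_diagonal:
  assumes at: "atomic_over Q m \<alpha>" and Q: "Q \<subseteq> gQuord A"
    and M: "\<And>i j. i < m \<Longrightarrow> j < m \<Longrightarrow> M i j \<in> A"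
    and rows: "\<And>i. i < m \<Longrightarrow> holds (map (\<lambda>j. M i j) [0..<m]) \<alpha>"
    and cols: "\<And>j. j < m \<Longrightarrow> holds (map (\<lambda>i. M i j) [0..<m]) \<alpha>"
  shows "holds (map (\<lambda>i. M i i) [0..<m]) \<alpha>"
proof (cases \<alpha>)
  case (In_Rel "is" \<sigma>)
  then have "\<sigma> \<in> gQuord A" and len: "length is = fst \<sigma>" and sub: "set is \<subseteq> {..<m}"
    using at Q by auto
  \<comment> \<open>Writing the arity as \<open>length is\<close> fixes the size of the matrices
    that transitivity of \<open>\<sigma>\<close> speaks of: the number of argument places of the
    atom, unrelated to \<open>m\<close>.\<close>
  then obtain R where \<sigma>: "\<sigma> = (length is, R)" and trans: "transitive_rel A (length is, R)"
    by (cases \<sigma>) (auto simp: gQuord_def)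
  have lt: "is ! k < m" if "k < length is" for k
    using sub that by (auto simp: subset_iff)
  define N where "N = (\<lambda>k l. M (is ! k) (is ! l))"
  have "\<forall>k<length is. \<forall>l<length is. N k l \<in> A"
    using M lt by (simp add: N_def)
  moreover have "\<forall>k<length is. map (\<lambda>l. N k l) [0..<length is] \<in> R"
    using rows lt by (simp add: N_def In_Rel \<sigma> map_nth_map_upt[OF sub])
  moreover have "\<forall>l<length is. map (\<lambda>k. N k l) [0..<length is] \<in> R"
    using cols lt by (simp add: N_def In_Rel \<sigma> map_nth_map_upt[OF sub])
  ultimately have "map (\<lambda>k. N k k) [0..<length is] \<in> R"
    using trans unfolding transitive_rel_def by blast
  then show ?thesis
    by (simp add: N_def In_Rel \<sigma> map_nth_map_upt[OF sub])
next
  case (Equal i j)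
  then have ij: "i < m" "j < m"
    using at by auto
  then have "M i i = M i j" "M i j = M j j"
    using rows[OF ij(1)] cols[OF ij(2)] Equal by auto
  then show ?thesis
    using Equal ij by simp
qed

text \<open>Selecting coordinates commutes with applying \<open>f\<close> componentwise, so
  preservation of \<open>\<sigma>\<close> passes to every atom built from it, even when variables
  are repeated or omitted.\<close>

lemma holds_operation:
  assumes at: "atomic_over Q m \<alpha>"
    and pres: "\<And>\<sigma>. \<sigma> \<in> Q \<Longrightarrow> preserves (n, f) \<sigma>"
    and len: "length rs = n"
    and rs: "\<And>r. r \<in> set rs \<Longrightarrow> holds r \<alpha>"
  shows "holds (map (\<lambda>j. f (map (\<lambda>r. r ! j) rs)) [0..<m]) \<alpha>"
proof (cases \<alpha>)
  case (In_Rel "is" \<sigma>)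
  then have "\<sigma> \<in> Q" and "length is = fst \<sigma>" and sub: "set is \<subseteq> {..<m}"
    using at by auto
  then obtain R where \<sigma>: "\<sigma> = (length is, R)" and p: "preserves (n, f) (length is, R)"
    using pres by (cases \<sigma>) auto
  \<comment> \<open>Each tuple of \<open>rs\<close> is cut down to the positions named in the atom;
    since it satisfies the atom, the result is a tuple of \<open>\<sigma>\<close>.\<close>
  define ss where "ss = map (\<lambda>r. map (\<lambda>i. r ! i) is) rs"
  have "length ss = n" "set ss \<subseteq> R"
    using len rs by (auto simp: ss_def In_Rel \<sigma>)
  then have "map (\<lambda>k. f (map (\<lambda>s. s ! k) ss)) [0..<length is] \<in> R"
    using p by (simp add: preserves_def)
  moreover have "map (\<lambda>k. f (map (\<lambda>s. s ! k) ss)) [0..<length is]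
      = map (\<lambda>k. f (map (\<lambda>r. r ! (is ! k)) rs)) [0..<length is]"
    by (simp add: ss_def comp_def)
  ultimately show ?thesis
    by (simp add: In_Rel \<sigma> map_nth_map_upt[OF sub])
next
  case (Equal i j)
  \<comment> \<open>At positions \<open>i\<close> and \<open>j\<close> the operation receives the
    same argument list, hence returns the same value.\<close>
  then have eq: "map (\<lambda>r. r ! i) rs = map (\<lambda>r. r ! j) rs"
    using rs by simp
  show ?thesis
    using Equal at by (simp add: eq del: map_eq_conv)
qed

text \<open>A conjunction defines the intersection of what its atoms define in
  \<open>tuples A m\<close>, so reflexivity and transitivity can be checked one atom at a
  time.\<close>

lemma qf_pp_closure_subset_gQuord:
  assumes "Q \<subseteq> gQuord A"
  shows "qf_pp_closure A Q \<subseteq> gQuord A"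
proof
  fix \<rho> assume "\<rho> \<in> qf_pp_closure A Q"
  then obtain m \<phi> where \<rho>: "\<rho> = (m, {as \<in> tuples A m. \<forall>\<alpha>\<in>set \<phi>. holds as \<alpha>})"
    and m: "m \<ge> 1" and at: "\<And>\<alpha>. \<alpha> \<in> set \<phi> \<Longrightarrow> atomic_over Q m \<alpha>"
    unfolding qf_pp_closure_def by blast
  have "relation_on A \<rho>"
    using m by (auto simp: \<rho> relation_on_def)
  moreover have "reflexive_rel A \<rho>"
    using holds_replicate[OF at assms] by (auto simp: \<rho> reflexive_rel_def tuples_def)
  moreover have "transitive_rel A \<rho>"
    unfolding transitive_rel_def \<rho> prod.case
  proof (intro allI impI CollectI conjI ballI)
    fix M :: "nat \<Rightarrow> nat \<Rightarrow> 'a"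
    assume M: "\<forall>i<m. \<forall>j<m. M i j \<in> A"
    then show "map (\<lambda>i. M i i) [0..<m] \<in> tuples A m"
      by (auto simp: tuples_def)
    fix \<alpha> assume \<alpha>: "\<alpha> \<in> set \<phi>"
    assume rows: "\<forall>i<m. map (\<lambda>j. M i j) [0..<m] \<in> {as \<in> tuples A m. \<forall>\<alpha>\<in>set \<phi>. holds as \<alpha>}"
      and cols: "\<forall>j<m. map (\<lambda>i. M i j) [0..<m] \<in> {as \<in> tuples A m. \<forall>\<alpha>\<in>set \<phi>. holds as \<alpha>}"
    show "holds (map (\<lambda>i. M i i) [0..<m]) \<alpha>"
    proof (rule holds_diagonal[where M = M, OF at[OF \<alpha>] assms])
      show "M i j \<in> A" if "i < m" "j < m" for i j
        using M that by blast
      show "holds (map (\<lambda>j. M i j) [0..<m]) \<alpha>" if "i < m" for i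
        using rows \<alpha> that by blast
      show "holds (map (\<lambda>i. M i j) [0..<m]) \<alpha>" if "j < m" for j
        using cols \<alpha> that by blast
    qed
  qed
  ultimately show "\<rho> \<in> gQuord A"
    by (simp add: gQuord_def)
qed

text \<open>Again each atom is treated separately. That \<open>g\<close> maps into \<open>A\<close>
  keeps the image tuple in \<open>tuples A m\<close>, which the atoms alone do not ensure, for
  instance when the conjunction is empty.\<close>

lemma qf_pp_closure_preserves:
  assumes "\<rho> \<in> qf_pp_closure A Q" and op: "operation_on A g"
    and pres: "\<And>\<sigma>. \<sigma> \<in> Q \<Longrightarrow> preserves g \<sigma>"
  shows "preserves g \<rho>"
proof -
  obtain m \<phi> where \<rho>: "\<rho> = (m, {as \<in> tuples A m. \<forall>\<alpha>\<in>set \<phi>. holds as \<alpha>})"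
    and at: "\<And>\<alpha>. \<alpha> \<in> set \<phi> \<Longrightarrow> atomic_over Q m \<alpha>"
    using assms(1) unfolding qf_pp_closure_def by blast
  obtain n f where g: "g = (n, f)"
    by fastforce
  show ?thesis
    unfolding preserves_def \<rho> g prod.case
  proof (intro allI impI CollectI conjI ballI)
    fix rs
    assume len: "length rs = n"
      and rs: "set rs \<subseteq> {as \<in> tuples A m. \<forall>\<alpha>\<in>set \<phi>. holds as \<alpha>}"
    have "map (\<lambda>r. r ! j) rs \<in> tuples A n" if "j < m" for j
      using len rs that by (fastforce simp: tuples_def)
    then show "map (\<lambda>j. f (map (\<lambda>r. r ! j) rs)) [0..<m] \<in> tuples A m"
      using op by (auto simp: g operation_on_def tuples_def)
    fix \<alpha> assume \<alpha>: "\<alpha> \<in> set \<phi>"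
    show "holds (map (\<lambda>j. f (map (\<lambda>r. r ! j) rs)) [0..<m]) \<alpha>"
      using holds_operation[OF at[OF \<alpha>] pres[unfolded g] len] rs \<alpha> by blast
  qed
qed

lemma subset_qf_pp_closure:
  assumes "\<And>\<sigma>. \<sigma> \<in> Q \<Longrightarrow> relation_on A \<sigma>"
  shows "Q \<subseteq> qf_pp_closure A Q"
proof
  fix \<sigma> assume "\<sigma> \<in> Q"
  obtain m R where \<sigma>: "\<sigma> = (m, R)"
    by fastforce
  have m: "m \<ge> 1" and R: "R \<subseteq> tuples A m"
    using assms[OF \<open>\<sigma> \<in> Q\<close>] by (auto simp: \<sigma> relation_on_def)
  \<comment> \<open>The single atom that lists all variables once and in order defines
    \<open>\<sigma>\<close> itself.\<close>
  let ?\<phi> = "[In_Rel [0..<m] \<sigma>]"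
  have "map (\<lambda>i. as ! i) [0..<m] = as" if "as \<in> tuples A m" for as
    using that map_nth[of as] by (simp add: tuples_def)
  then have "R = {as \<in> tuples A m. \<forall>\<alpha>\<in>set ?\<phi>. holds as \<alpha>}"
    using R by (auto simp: \<sigma>)
  moreover have "\<forall>\<alpha>\<in>set ?\<phi>. atomic_over Q m \<alpha>"
    using \<open>\<sigma> \<in> Q\<close> by (auto simp: \<sigma>)
  ultimately show "\<sigma> \<in> qf_pp_closure A Q"
    using m unfolding qf_pp_closure_def \<sigma> by blast
qed

theorem proposition2p2:
  fixes A :: "'a set"
  assumes "finite A" and "A \<noteq> {}"
  shows "(\<forall>Q. Q \<subseteq> gQuord A \<longrightarrow> qf_pp_closure A Q \<subseteq> gQuord A)
       \<and> qf_pp_closure A (gQuord A) = gQuord A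
       \<and> (\<forall>F Q. (\<forall>f\<in>F. operation_on A f) \<longrightarrow> Q \<subseteq> gQuord_alg A F
             \<longrightarrow> qf_pp_closure A Q \<subseteq> gQuord_alg A F)"
proof (intro conjI allI impI)
  fix Q assume "Q \<subseteq> gQuord A"
  then show "qf_pp_closure A Q \<subseteq> gQuord A"
    by (rule qf_pp_closure_subset_gQuord)
next
  show "qf_pp_closure A (gQuord A) = gQuord A"
    \<comment> \<open>One inclusion is the closure result for the largest choice of
      \<open>Q\<close>; the other holds since generalized quasiorders are relations on
      \<open>A\<close>.\<close>
    by (intro equalityI qf_pp_closure_subset_gQuord subset_qf_pp_closure)
      (auto simp: gQuord_def)
next
  fix F :: "'a operation set" and Q
  assume F: "\<forall>f\<in>F. operation_on A f" and Q: "Q \<subseteq> gQuord_alg A F"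
  have pres: "preserves f \<sigma>" if "f \<in> F" "\<sigma> \<in> Q" for f \<sigma>
    using Q that unfolding gQuord_alg_def by blast
  have "Q \<subseteq> gQuord A"
    using Q unfolding gQuord_alg_def by blast
  then have "qf_pp_closure A Q \<subseteq> gQuord A"
    by (rule qf_pp_closure_subset_gQuord)
  moreover have "preserves f \<rho>" if "\<rho> \<in> qf_pp_closure A Q" "f \<in> F" for f \<rho>
    using qf_pp_closure_preserves[OF that(1)] F pres that(2) by blast
  ultimately show "qf_pp_closure A Q \<subseteq> gQuord_alg A F"
    unfolding gQuord_alg_def by blast
qed

end
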